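(* Let $\mathcal{X}\subset\mathbb{R}^{n}$, let $f:\mathcal{X}\to\mathbb{R}^{n}$ and $g:\mathcal{X}\to\mathbb{R}^{n\times m}$ be locally Lipschitz continuous, and let $f':\mathcal{X}\times\mathbb{R}\to\mathbb{R}$ be locally Lipschitz continuous. Consider the augmented system with state $(x,\alpha)\in\mathcal{X}\times\mathbb{R}$ and control input $u\in\mathbb{R}^m$, $$\dot x = f(x)+g(x)u,\qquad \dot\alpha = f'(x,\alpha).$$ Let $h:\mathcal{X}\to\mathbb{R}$ be continuously differentiable, let $\mathcal{S}=\{x\in\mathcal{X}: h(x)\ge 0\}$, and suppose that $h$ is a Rate-Tunable CBF for this augmented system on $\mathcal{S}$. Let $u^r:\mathcal{X}\to\mathbb{R}^m$ be a Lipschitz continuous reference controller, and let the system be controlled by $u=\pi(x,\alpha)$, where $$\pi(x,\alpha)=\underset{u\in\mathbb{R}^m}{\operatorname{argmin}}\ \|u-u^r(x)\|^2\quad\text{subject to}\quad \frac{\partial h}{\partial x}(x)\big(f(x)+g(x)u\big)\ge-\alpha\,h(x).$$ Then the set $\mathcal{S}$ is forward invariant for the closed-loop system.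
   Context: Rate-Tunable CBF: with the data above, a continuously differentiable function $h:\mathcal{X}\to\mathbb{R}$ is a Rate-Tunable Control Barrier Function (CBF) for the augmented system on $\mathcal{S}=\{x\in\mathcal{X}:h(x)\ge0\}$ if $$\sup_{u\in\mathbb{R}^{m}}\left[\frac{\partial h}{\partial x}(x)\big(f(x)+g(x)u\big)\right]\ \ge\ -\alpha\,h(x)\qquad\text{for all }x\in\mathcal{X}\text{ and all }\alpha\in\mathbb{R}.$$ The control input is unbounded (the input set is all of $\mathbb{R}^m$). Notation: $\partial h/\partial x$ is the gradient of $h$ as a row vector; $\|\cdot\|$ is the Euclidean norm. Forward invariance of $\mathcal{S}$: every solution $(x(t),\alpha(t))$ of the closed-loop system $\dot x=f(x)+g(x)\pi(x,\alpha)$, $\dot\alpha=f'(x,\alpha)$ with $x(0)\in\mathcal{S}$ satisfies $x(t)\in\mathcal{S}$ for all $t\ge0$ at which it is defined. *)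

theory Defs
  imports "HOL-Analysis.Analysis"
begin

text \<open>The library's \<^const>\<open>local_lipschitz\<close> is about time-dependent maps;
  for a time-independent map the time set is irrelevant.\<close>

definition locally_lipschitz_on :: "'a::metric_space set \<Rightarrow> ('a \<Rightarrow> 'b::metric_space) \<Rightarrow> bool" where
  "locally_lipschitz_on X f \<longleftrightarrow> local_lipschitz (UNIV :: real set) X (\<lambda>_. f)"

text \<open>The set \<open>X\<close> is not required to be open, so the derivative of \<open>h\<close> is taken within \<open>X\<close> and
  the gradient \<open>dh\<close> is carried explicitly. If \<open>X\<close> is open, then \<open>dh\<close> is determined on \<open>X\<close> by \<open>h\<close>.
  The gradient of a \<open>C\<^sup>1\<close> extension of \<open>h\<close> to a neighbourhood of \<open>X\<close> is an instance.\<close>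

definition continuously_differentiable_on ::
    "(real^'n) set \<Rightarrow> (real^'n \<Rightarrow> real) \<Rightarrow> (real^'n \<Rightarrow> real^'n) \<Rightarrow> bool" where
  "continuously_differentiable_on X h dh \<longleftrightarrow>
     (\<forall>x\<in>X. (h has_derivative (\<lambda>v. dh x \<bullet> v)) (at x within X)) \<and> continuous_on X dh"

definition superlevel_set :: "(real^'n) set \<Rightarrow> (real^'n \<Rightarrow> real) \<Rightarrow> (real^'n) set" where
  "superlevel_set X h = {x \<in> X. h x \<ge> 0}"

text \<open>The supremum over the unbounded input set may be infinite, hence it is taken in
  \<^typ>\<open>ereal\<close>. The condition does not involve the dynamics of \<open>\<alpha>\<close>.\<close>

definition rate_tunable_cbf ::
    "(real^'n) set \<Rightarrow> (real^'n \<Rightarrow> real^'n) \<Rightarrow> (real^'n \<Rightarrow> real^'m^'n) \<Rightarrow>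
     (real^'n \<Rightarrow> real) \<Rightarrow> (real^'n \<Rightarrow> real^'n) \<Rightarrow> bool" where
  "rate_tunable_cbf X f g h dh \<longleftrightarrow>
     continuously_differentiable_on X h dh \<and>
     (\<forall>x\<in>X. \<forall>\<alpha>::real.
        (SUP u\<in>UNIV. ereal (dh x \<bullet> (f x + g x *v u))) \<ge> ereal (- \<alpha> * h x))"

definition cbf_controller ::
    "(real^'n \<Rightarrow> real^'n) \<Rightarrow> (real^'n \<Rightarrow> real^'m^'n) \<Rightarrow> (real^'n \<Rightarrow> real) \<Rightarrow> (real^'n \<Rightarrow> real^'n) \<Rightarrow>
     (real^'n \<Rightarrow> real^'m) \<Rightarrow> real^'n \<Rightarrow> real \<Rightarrow> real^'m" where
  "cbf_controller f g h dh ur x \<alpha> =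
     arg_min (\<lambda>u. (norm (u - ur x))\<^sup>2) (\<lambda>u. dh x \<bullet> (f x + g x *v u) \<ge> - \<alpha> * h x)"

definition closed_loop_solution ::
    "(real^'n) set \<Rightarrow> (real^'n \<Rightarrow> real^'n) \<Rightarrow> (real^'n \<Rightarrow> real^'m^'n) \<Rightarrow> ((real^'n) \<times> real \<Rightarrow> real) \<Rightarrow>
     (real^'n \<Rightarrow> real \<Rightarrow> real^'m) \<Rightarrow> real set \<Rightarrow> (real \<Rightarrow> real^'n) \<Rightarrow> (real \<Rightarrow> real) \<Rightarrow> bool" where
  "closed_loop_solution X f g f' \<pi> T x \<alpha> \<longleftrightarrow>
     is_interval T \<and> 0 \<in> T \<and>
     (\<forall>t\<in>T. x t \<in> X \<and>
        (x has_vector_derivative f (x t) + g (x t) *v \<pi> (x t) (\<alpha> t)) (at t within T) \<and>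
        (\<alpha> has_real_derivative f' (x t, \<alpha> t)) (at t within T))"

definition forward_invariant ::
    "(real^'n) set \<Rightarrow> (real^'n) set \<Rightarrow> (real^'n \<Rightarrow> real^'n) \<Rightarrow> (real^'n \<Rightarrow> real^'m^'n) \<Rightarrow>
     ((real^'n) \<times> real \<Rightarrow> real) \<Rightarrow> (real^'n \<Rightarrow> real \<Rightarrow> real^'m) \<Rightarrow> bool" where
  "forward_invariant S X f g f' \<pi> \<longleftrightarrow>
     (\<forall>T x \<alpha>. closed_loop_solution X f g f' \<pi> T x \<alpha> \<and> x 0 \<in> S \<longrightarrow>
        (\<forall>t\<in>T. t \<ge> 0 \<longrightarrow> x t \<in> S))"

end

theory Submission
  imports Defs
begin

text \<open>Two facts carry the proof. First, the quadratic program that defines the controller has a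
  solution at every \<open>x \<in> X\<close> for every \<open>\<alpha>\<close>: its constraint is affine in \<open>u\<close>, and an affine function
  on the whole space is either constant or unbounded above, so a bound on its supremum is a bound on
  a value that it takes (\<open>affine_attains_SUP_bound\<close>). The feasible set is thus closed and non-empty
  and has a point nearest to \<open>ur x\<close>, so the input that is applied obeys the constraint
  (\<open>cbf_controller_feasible\<close>).

  Second, along a closed-loop solution the constraint says that \<open>y(t) = h(x(t))\<close> satisfies
  \<open>y'(t) \<ge> - \<alpha>(t) y(t)\<close>. As a solution of a differential equation, \<open>\<alpha>\<close> is continuous in \<open>t\<close>, so
  \<open>t \<mapsto> y(t) exp(\<integral>\<^sub>0\<^sup>t \<alpha>)\<close> is non-decreasing
  (\<open>linear_differential_inequality\<close>), and \<open>y(0) \<ge> 0\<close> forces \<open>y(t) \<ge> 0\<close>, whatever the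
  sign of \<open>\<alpha>\<close>, because the integrating factor is positive.\<close>

lemma affine_attains_SUP_bound:
  fixes w :: "'a::real_inner"
  assumes "(SUP u\<in>UNIV. ereal (a + w \<bullet> u)) \<ge> ereal c"
  shows "\<exists>u. a + w \<bullet> u \<ge> c"
proof (cases "w = 0")
  case True
  then show ?thesis
    using assms by simp
next
  case False
  \<comment> \<open>Along the normal direction \<open>w\<close> every level is reached exactly.\<close>
  have "a + w \<bullet> (((c - a) / (w \<bullet> w)) *\<^sub>R w) = c"
    using False by simp
  then show ?thesis
    by (metis order_refl)
qed

text \<open>Existence of a minimiser is what makes \<^const>\<open>arg_min\<close> meaningful: without it the choice
  operator could return an infeasible point.\<close>

lemma arg_min_norm_diff_mem:
  fixes p :: "'a::euclidean_space"
  assumes "closed {u. P u}" and "\<exists>u. P u"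
  shows "P (arg_min (\<lambda>u. (norm (u - p))\<^sup>2) P)"
proof -
  obtain u where u: "P u" "\<And>v. P v \<Longrightarrow> dist p u \<le> dist p v"
    using distance_attains_inf[OF assms(1), of p] assms(2) by auto
  have "is_arg_min (\<lambda>u. (norm (u - p))\<^sup>2) P u"
    using u by (auto simp: is_arg_min_def not_less dist_norm norm_minus_commute power_mono)
  then show ?thesis
    unfolding arg_min_def by (rule someI2) (simp add: is_arg_min_def)
qed

lemma cbf_controller_feasible:
  assumes "rate_tunable_cbf X f g h dh" and "x \<in> X"
  shows "dh x \<bullet> (f x + g x *v cbf_controller f g h dh ur x \<alpha>) \<ge> - \<alpha> * h x"
proof -
  have affine: "dh x \<bullet> (f x + g x *v u) = dh x \<bullet> f x + (dh x v* g x) \<bullet> u" for u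
    by (simp add: inner_add_right dot_lmul_matrix)
  have "(SUP u\<in>UNIV. ereal (dh x \<bullet> (f x + g x *v u))) \<ge> ereal (- \<alpha> * h x)"
    using assms unfolding rate_tunable_cbf_def by blast
  then have "\<exists>u. dh x \<bullet> (f x + g x *v u) \<ge> - \<alpha> * h x"
    unfolding affine by (rule affine_attains_SUP_bound)
  moreover have "closed {u. dh x \<bullet> (f x + g x *v u) \<ge> - \<alpha> * h x}"
    unfolding affine by (intro closed_Collect_le continuous_intros)
  ultimately show ?thesis
    unfolding cbf_controller_def
    by (intro arg_min_norm_diff_mem[where P = "\<lambda>u. dh x \<bullet> (f x + g x *v u) \<ge> - \<alpha> * h x"])
qed

text \<open>A Gronwall-type bound from below: multiplying by the integrating factor turns the inequality
  into a non-negative derivative, and the mean value theorem gives monotonicity.\<close>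

lemma linear_differential_inequality:
  fixes y y' \<alpha> :: "real \<Rightarrow> real"
  assumes "a \<le> b" and cont: "continuous_on {a..b} \<alpha>"
    and deriv: "\<And>s. s \<in> {a..b} \<Longrightarrow> (y has_real_derivative y' s) (at s within {a..b})"
    and ineq: "\<And>s. s \<in> {a..b} \<Longrightarrow> y' s \<ge> - \<alpha> s * y s"
  shows "y a \<le> y b * exp (integral {a..b} \<alpha>)"
proof (cases "a = b")
  case False
  define A where "A s = integral {a..s} \<alpha>" for s
  have dA: "(A has_real_derivative \<alpha> s) (at s within {a..b})" if "s \<in> {a..b}" for s
    unfolding A_def using integral_has_real_derivative[OF cont that] .
  have "((\<lambda>s. y s * exp (A s)) has_real_derivative (y' s + \<alpha> s * y s) * exp (A s))
          (at s within {a..b})" if "s \<in> {a..b}" for s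
    by (rule derivative_eq_intros deriv[OF that] dA[OF that] refl)+ (simp add: algebra_simps)
  then obtain s where s: "s \<in> {a<..<b}"
    and "y b * exp (A b) - y a * exp (A a) = (y' s + \<alpha> s * y s) * exp (A s) * (b - a)"
    using mvt_simple[of a b "\<lambda>s. y s * exp (A s)" "\<lambda>s. (*) ((y' s + \<alpha> s * y s) * exp (A s))"]
      False \<open>a \<le> b\<close> by (auto simp: has_field_derivative_def)
  moreover have "(y' s + \<alpha> s * y s) * exp (A s) * (b - a) \<ge> 0"
    using ineq[of s] s by (intro mult_nonneg_nonneg) auto
  ultimately show ?thesis
    by (simp add: A_def)
qed simp

theorem theorem1:
  fixes X :: "(real^'n) set"
    and f :: "real^'n \<Rightarrow> real^'n"
    and g :: "real^'n \<Rightarrow> real^'m^'n"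
    and f' :: "(real^'n) \<times> real \<Rightarrow> real"
    and h :: "real^'n \<Rightarrow> real"
    and dh :: "real^'n \<Rightarrow> real^'n"
    and ur :: "real^'n \<Rightarrow> real^'m"
  assumes "locally_lipschitz_on X f"
    and "locally_lipschitz_on X g"
    and "locally_lipschitz_on (X \<times> UNIV) f'"
    and "continuously_differentiable_on X h dh"
    and "rate_tunable_cbf X f g h dh"
    and "\<exists>L. L-lipschitz_on X ur"
  shows "forward_invariant (superlevel_set X h) X f g f' (cbf_controller f g h dh ur)"
  unfolding forward_invariant_def
proof (intro allI impI ballI, elim conjE)
  fix T x \<alpha> t
  assume sol: "closed_loop_solution X f g f' (cbf_controller f g h dh ur) T x \<alpha>"
    and init: "x 0 \<in> superlevel_set X h" and "t \<in> T" "0 \<le> t"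
  define x' where "x' s = f (x s) + g (x s) *v cbf_controller f g h dh ur (x s) (\<alpha> s)" for s
  have "{0..t} \<subseteq> T"
    using sol \<open>t \<in> T\<close> mem_is_interval_1_I[of T 0 t]
    unfolding closed_loop_solution_def by auto
  have xX: "x s \<in> X" and dx: "(x has_vector_derivative x' s) (at s within {0..t})"
    and d\<alpha>: "(\<alpha> has_real_derivative f' (x s, \<alpha> s)) (at s within {0..t})"
    if "s \<in> {0..t}" for s
  proof -
    have "s \<in> T"
      using that \<open>{0..t} \<subseteq> T\<close> by (rule rev_subsetD)
    then have "x s \<in> X" "(x has_vector_derivative x' s) (at s within T)"
      "(\<alpha> has_real_derivative f' (x s, \<alpha> s)) (at s within T)"
      using sol unfolding closed_loop_solution_def x'_def by simp_all
    then show "x s \<in> X" "(x has_vector_derivative x' s) (at s within {0..t})"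
      "(\<alpha> has_real_derivative f' (x s, \<alpha> s)) (at s within {0..t})"
      using \<open>{0..t} \<subseteq> T\<close>
      by (auto intro: has_vector_derivative_within_subset has_field_derivative_subset)
  qed
  have "((\<lambda>s. h (x s)) has_real_derivative dh (x s) \<bullet> x' s) (at s within {0..t})"
    if "s \<in> {0..t}" for s
  proof -
    \<comment> \<open>\<open>h\<close> is differentiable only within \<open>X\<close>; the chain rule applies because the trajectory
      stays in \<open>X\<close>.\<close>
    have "(h has_derivative (\<lambda>v. dh (x s) \<bullet> v)) (at (x s) within x ` {0..t})"
    proof (rule has_derivative_subset)
      show "(h has_derivative (\<lambda>v. dh (x s) \<bullet> v)) (at (x s) within X)"
        using assms(4) xX[OF that] unfolding continuously_differentiable_on_def by simp
      show "x ` {0..t} \<subseteq> X"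
        using xX by auto
    qed
    from diff_chain_within[OF dx[OF that, unfolded has_vector_derivative_def] this]
    show ?thesis
      by (simp add: has_field_derivative_def o_def mult_commute_abs)
  qed
  moreover have "dh (x s) \<bullet> x' s \<ge> - \<alpha> s * h (x s)" if "s \<in> {0..t}" for s
    unfolding x'_def using cbf_controller_feasible[OF assms(5) xX[OF that]] .
  moreover have "continuous_on {0..t} \<alpha>"
    using d\<alpha> by (rule DERIV_continuous_on)
  ultimately have "h (x 0) \<le> h (x t) * exp (integral {0..t} \<alpha>)"
    using linear_differential_inequality[OF \<open>0 \<le> t\<close>, of \<alpha> "\<lambda>s. h (x s)" "\<lambda>s. dh (x s) \<bullet> x' s"]
    by blast
  then have "0 \<le> h (x t) * exp (integral {0..t} \<alpha>)"
    using init by (simp add: superlevel_set_def)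
  then show "x t \<in> superlevel_set X h"
    using xX[of t] \<open>0 \<le> t\<close> by (simp add: superlevel_set_def zero_le_mult_iff)
qed

end
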